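(* Let $X$ be a separable F-space equipped with a translation-invariant metric $d$ compatible with its topology, and let $T:X\to X$ be a continuous linear operator. Fix $\delta>0$. Assume that $T$ satisfies the $\delta$-Hypercyclicity Criterion along a strictly increasing sequence $(n_k)$. Then for every pair of nonempty open sets $U,O\subset X$, there exists $K\in\mathbb N$ such that $$T^{n_k}(U)\cap B_\delta(O)\neq\varnothing\qquad\text{for all } k\ge K.$$
   Context: An F-space is a topological vector space (over $\mathbb R$ or $\mathbb C$) whose topology is induced by a complete translation-invariant metric. For $A\subset X$ and $r>0$, $B_r(A):=\{x\in X:\inf_{y\in A}d(x,y)<r\}$. $T$ satisfies the $\delta$-Hypercyclicity Criterion along a strictly increasing sequence $(n_k)$ of (nonnegative) integers if there exist dense subsets $V,W\subset X$ and maps $S_{n_k}:W\to X$ (not assumed linear or continuous) such that: (1) for every $v\in V$, $T^{n_k}v\to0$; (2) for every $w\in W$, $S_{n_k}w\to0$; (3) for every $w\in W$ there exists $k_0\in\mathbb N$ such that $d(T^{n_k}(S_{n_k}w),w)<\delta$ for all $k\ge k_0$. *)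

theory Defs
  imports "HOL-Analysis.Analysis"
begin

text \<open>
  By the Gelfand--Mazur theorem, the instances of \<^class>\<open>real_normed_field\<close> are, up to isometric
  isomorphism, exactly the real and the complex numbers.
\<close>

locale topological_vector_space = vector_space scale
  for scale :: "'k::real_normed_field \<Rightarrow> 'a::topological_ab_group_add \<Rightarrow> 'a" +
  assumes continuous_scale: "continuous_on UNIV (\<lambda>(c, x). scale c x)"

definition compatible_metric :: "('a::topological_space \<Rightarrow> 'a \<Rightarrow> real) \<Rightarrow> bool" where
  "compatible_metric d \<longleftrightarrow>
     Metric_space UNIV d \<and> Metric_space.mtopology UNIV d = (euclidean :: 'a topology)"

definition translation_invariant :: "('a::ab_group_add \<Rightarrow> 'a \<Rightarrow> real) \<Rightarrow> bool" where
  "translation_invariant d \<longleftrightarrow> (\<forall>x y z. d (x + z) (y + z) = d x y)"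

locale F_space = topological_vector_space scale
  for scale :: "'k::real_normed_field \<Rightarrow> 'a::topological_ab_group_add \<Rightarrow> 'a" +
  assumes complete_invariant_metric:
    "\<exists>d :: 'a \<Rightarrow> 'a \<Rightarrow> real.
       compatible_metric d \<and> translation_invariant d \<and> Metric_space.mcomplete UNIV d"

text \<open>The infimum is taken in the extended reals, so that the neighbourhood of the empty set is empty.\<close>

definition nbhd :: "('a \<Rightarrow> 'a \<Rightarrow> real) \<Rightarrow> real \<Rightarrow> 'a set \<Rightarrow> 'a set" where
  "nbhd d r A = {x. (INF y\<in>A. ereal (d x y)) < ereal r}"

text \<open>
  The map \<open>S (n k)\<close> is only ever applied to elements of \<open>W\<close>; its values outside \<open>W\<close> are irrelevant.
\<close>

definition delta_hypercyclicity_criterion ::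
  "('a::topological_ab_group_add \<Rightarrow> 'a \<Rightarrow> real) \<Rightarrow> ('a \<Rightarrow> 'a) \<Rightarrow> real \<Rightarrow> (nat \<Rightarrow> nat) \<Rightarrow> bool" where
  "delta_hypercyclicity_criterion d T \<delta> n \<longleftrightarrow>
     strict_mono n \<and>
     (\<exists>(V :: 'a set) (W :: 'a set) (S :: nat \<Rightarrow> 'a \<Rightarrow> 'a).
        closure V = UNIV \<and> closure W = UNIV \<and>
        (\<forall>v\<in>V. (\<lambda>k. (T ^^ n k) v) \<longlonglongrightarrow> 0) \<and>
        (\<forall>w\<in>W. (\<lambda>k. S (n k) w) \<longlonglongrightarrow> 0) \<and>
        (\<forall>w\<in>W. \<exists>k0. \<forall>k\<ge>k0. d ((T ^^ n k) (S (n k) w)) w < \<delta>))"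

end

theory Submission
  imports Defs
begin

text \<open>
  Let \<open>V\<close>, \<open>W\<close> and \<open>S\<close> be as in the criterion, and let \<open>U\<close> and \<open>G\<close> be open and nonempty.
  Choose \<open>v \<in> V \<inter> U\<close> and \<open>w \<in> W \<inter> G\<close>, which is possible by density, and perturb \<open>v\<close> to
  \<open>x\<^sub>k = v + S (n k) w\<close>. Since \<open>S (n k) w \<longlonglongrightarrow> 0\<close>, the points \<open>x\<^sub>k\<close> eventually lie in \<open>U\<close>, and
  additivity gives \<open>T\<^bsup>n k\<^esup> x\<^sub>k = T\<^bsup>n k\<^esup> v + T\<^bsup>n k\<^esup> (S (n k) w)\<close>.

  The point of \<open>G\<close> to compare this with is not \<open>w\<close> but \<open>y\<^sub>k = T\<^bsup>n k\<^esup> v + w\<close>, which tends to \<open>w\<close>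
  and so eventually lies in the open set \<open>G\<close>. The common summand then cancels by translation
  invariance, so that the distance from \<open>T\<^bsup>n k\<^esup> x\<^sub>k\<close> to \<open>y\<^sub>k\<close> is exactly
  \<open>d (T\<^bsup>n k\<^esup> (S (n k) w)) w\<close>, which is eventually below \<open>\<delta>\<close>.
\<close>

lemma in_nbhd_iff: "x \<in> nbhd d r A \<longleftrightarrow> (\<exists>y\<in>A. d x y < r)"
  by (simp add: nbhd_def INF_less_iff)

lemma open_inter_dense_nonempty:
  assumes "open A" "A \<noteq> {}" "closure D = UNIV"
  shows "D \<inter> A \<noteq> {}"
  using open_Int_closure_eq_empty[OF assms(1), of D] assms(2,3) by auto

lemma funpow_add_hom:
  fixes f :: "'a::plus \<Rightarrow> 'a"
  assumes "\<And>x y. f (x + y) = f x + f y"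
  shows "(f ^^ m) (x + y) = (f ^^ m) x + (f ^^ m) y"
  by (induction m) (simp_all add: assms)

theorem proposition3p5:
  fixes scale :: "'k::real_normed_field \<Rightarrow> 'a::topological_ab_group_add \<Rightarrow> 'a"
    and d :: "'a \<Rightarrow> 'a \<Rightarrow> real"
    and T :: "'a \<Rightarrow> 'a"
    and \<delta> :: real
    and n :: "nat \<Rightarrow> nat"
  assumes "F_space scale"
    and "separable_space (euclidean :: 'a topology)"
    and "compatible_metric d"
    and "translation_invariant d"
    and "Vector_Spaces.linear scale scale T"
    and "continuous_on UNIV T"
    and "\<delta> > 0"
    and "delta_hypercyclicity_criterion d T \<delta> n"
  shows "\<forall>U G :: 'a set. open U \<and> U \<noteq> {} \<and> open G \<and> G \<noteq> {} \<longrightarrow>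
           (\<exists>K. \<forall>k\<ge>K. (T ^^ n k) ` U \<inter> nbhd d \<delta> G \<noteq> {})"
proof (intro allI impI)
  fix U G :: "'a set"
  assume UG: "open U \<and> U \<noteq> {} \<and> open G \<and> G \<noteq> {}"
  obtain V W :: "'a set" and S :: "nat \<Rightarrow> 'a \<Rightarrow> 'a"
    where dense: "closure V = UNIV" "closure W = UNIV"
      and T_lim: "\<forall>v\<in>V. (\<lambda>k. (T ^^ n k) v) \<longlonglongrightarrow> 0"
      and S_lim: "\<forall>w\<in>W. (\<lambda>k. S (n k) w) \<longlonglongrightarrow> 0"
      and TS: "\<forall>w\<in>W. \<exists>k0. \<forall>k\<ge>k0. d ((T ^^ n k) (S (n k) w)) w < \<delta>"
    using assms(8) unfolding delta_hypercyclicity_criterion_def by (elim conjE exE)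
  obtain v w where v: "v \<in> V" "v \<in> U" and w: "w \<in> W" "w \<in> G"
    using open_inter_dense_nonempty[OF _ _ dense(1), of U]
      open_inter_dense_nonempty[OF _ _ dense(2), of G] UG by auto
  have T_add: "T (x + y) = T x + T y" for x y
    using module_hom.add[OF Vector_Spaces.linear.axioms(3)[OF assms(5)]] .
  have "(\<lambda>k. v + S (n k) w) \<longlonglongrightarrow> v"
    using tendsto_add[OF tendsto_const S_lim[rule_format, OF w(1)]] by simp
  then have ev_U: "\<forall>\<^sub>F k in sequentially. v + S (n k) w \<in> U"
    using UG v(2) by (auto dest: topological_tendstoD)
  have "(\<lambda>k. (T ^^ n k) v + w) \<longlonglongrightarrow> w"
    using tendsto_add[OF T_lim[rule_format, OF v(1)] tendsto_const] by simp
  then have ev_G: "\<forall>\<^sub>F k in sequentially. (T ^^ n k) v + w \<in> G"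
    using UG w(2) by (auto dest: topological_tendstoD)
  have ev_d: "\<forall>\<^sub>F k in sequentially. d ((T ^^ n k) (S (n k) w)) w < \<delta>"
    using TS[rule_format, OF w(1)] by (simp add: eventually_sequentially)
  have "\<forall>\<^sub>F k in sequentially. (T ^^ n k) ` U \<inter> nbhd d \<delta> G \<noteq> {}"
    using ev_U ev_G ev_d
  proof eventually_elim
    case (elim k)
    have "d ((T ^^ n k) (v + S (n k) w)) ((T ^^ n k) v + w)
        = d ((T ^^ n k) (S (n k) w) + (T ^^ n k) v) (w + (T ^^ n k) v)"
      by (simp add: funpow_add_hom[OF T_add] add.commute)
    also have "\<dots> = d ((T ^^ n k) (S (n k) w)) w"
      using assms(4) by (simp add: translation_invariant_def)
    finally have "(T ^^ n k) (v + S (n k) w) \<in> nbhd d \<delta> G"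
      using elim(2,3) unfolding in_nbhd_iff by (intro bexI[of _ "(T ^^ n k) v + w"]) simp_all
    then show ?case
      using elim(1) by blast
  qed
  then show "\<exists>K. \<forall>k\<ge>K. (T ^^ n k) ` U \<inter> nbhd d \<delta> G \<noteq> {}"
    by (simp add: eventually_sequentially)
qed

end
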